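(* Let $X$ be a standard Borel space and let $\Phi=(\Phi_n)$ be a Markov chain on $X$ with transition probability kernel $\mathsf{M}=(m_x)_{x\in X}$ having the Feller property. Suppose that $\Phi$ is irreducible and that its Feller operator $P:C_b(X,\mathbb{R})\to C_b(X,\mathbb{R})$, $P\varphi(x)=\int_X\varphi(y)\,dm_x(y)$, is a bounded linear operator. Then every conformal measure is fully supported; that is, if $\nu$ is a Borel probability measure on $X$ with $\mathscr{T}\nu=\lambda\nu$ for some $\lambda>0$, then $\nu(U)>0$ for every nonempty open set $U\subset X$.
   Context: A standard Borel space $X$ is taken with a metric making it a complete separable metric space, with its Borel sigma-algebra $\mathscr{B}(X)$. $C_b(X,\mathbb{R})$ is the space of bounded continuous real functions with the supremum norm. A transition probability kernel is a family $(m_x)_{x\in X}$ of Borel probability measures such that $x\mapsto m_x(A)$ is measurable for every Borel $A$. It has the Feller property if $P\varphi\in C_b(X,\mathbb{R})$ for every $\varphi\in C_b(X,\mathbb{R})$. The Markov operator on Borel probability measures is $\mathscr{T}\mu(A)=\int_X m_x(A)\,d\mu(x)$; a probability measure $\nu$ is called conformal (for $\mathscr{T}$) if $\mathscr{T}\nu=\lambda\nu$ for some $\lambda>0$. The chain is irreducible if for every non-negative, not identically zero $\varphi\in C_b(X,\mathbb{R})$ and every $x\in X$ there exists $n\in\mathbb{N}=\{1,2,\dots\}$ with $P^n\varphi(x)>0$. *)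

theory Defs
  imports "HOL-Probability.Probability"
begin

definition transition_kernel :: "('a::polish_space \<Rightarrow> 'a measure) \<Rightarrow> bool" where
  "transition_kernel m \<longleftrightarrow>
     (\<forall>x. prob_space (m x) \<and> sets (m x) = sets borel) \<and>
     (\<forall>A\<in>sets borel. (\<lambda>x. measure (m x) A) \<in> borel_measurable borel)"

lemma transition_kernel_iff_measurable:
  "transition_kernel m \<longleftrightarrow> m \<in> borel \<rightarrow>\<^sub>M prob_algebra borel"
proof
  assume m: "transition_kernel m"
  have "m \<in> borel \<rightarrow>\<^sub>M subprob_algebra borel"
  proof (rule measurable_subprob_algebra)
    fix A :: "'a set" assume "A \<in> sets borel"
    moreover have "(\<lambda>x. emeasure (m x) A) = (\<lambda>x. ennreal (measure (m x) A))"
      using m by (auto simp: transition_kernel_def prob_space_def finite_measure.emeasure_eq_measure)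
    ultimately show "(\<lambda>x. emeasure (m x) A) \<in> borel_measurable borel"
      using m by (simp add: transition_kernel_def)
  qed (use m in \<open>auto simp: transition_kernel_def prob_space_imp_subprob_space\<close>)
  then show "m \<in> borel \<rightarrow>\<^sub>M prob_algebra borel"
    using m unfolding prob_algebra_def
    by (intro measurable_restrict_space2) (auto simp: transition_kernel_def)
next
  assume m: "m \<in> borel \<rightarrow>\<^sub>M prob_algebra borel"
  then have "prob_space (m x) \<and> sets (m x) = sets borel" for x
    using measurable_space[OF m, of x] by (auto simp: space_prob_algebra)
  moreover have "(\<lambda>x. measure (m x) A) \<in> borel_measurable borel" if "A \<in> sets borel" for A
    using m measurable_measure_prob_algebra[OF that] by (rule measurable_compose)
  ultimately show "transition_kernel m"
    by (simp add: transition_kernel_def)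
qed

text \<open>The Markov property is taken with respect to the natural filtration; the initial
  distribution of the chain is arbitrary.\<close>

definition natural_filtration ::
    "'w measure \<Rightarrow> (nat \<Rightarrow> 'w \<Rightarrow> 'a::polish_space) \<Rightarrow> nat \<Rightarrow> 'w measure" where
  "natural_filtration \<Omega> \<Phi> n = (SUP k\<in>{..n}. vimage_algebra (space \<Omega>) (\<Phi> k) borel)"

definition markov_chain ::
    "'w measure \<Rightarrow> (nat \<Rightarrow> 'w \<Rightarrow> 'a::polish_space) \<Rightarrow> ('a \<Rightarrow> 'a measure) \<Rightarrow> bool" where
  "markov_chain \<Omega> \<Phi> m \<longleftrightarrow>
     prob_space \<Omega> \<and> (\<forall>n. \<Phi> n \<in> \<Omega> \<rightarrow>\<^sub>M borel) \<and>
     (\<forall>n. \<forall>A\<in>sets borel. AE \<omega> in \<Omega>.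
        real_cond_exp \<Omega> (natural_filtration \<Omega> \<Phi> n) (\<lambda>\<omega>'. indicator A (\<Phi> (Suc n) \<omega>')) \<omega>
          = measure (m (\<Phi> n \<omega>)) A)"

definition feller_property :: "('a::polish_space \<Rightarrow> 'a measure) \<Rightarrow> bool" where
  "feller_property m \<longleftrightarrow>
     (\<forall>\<phi> :: 'a \<Rightarrow>\<^sub>C real. (\<lambda>x. \<integral>y. apply_bcontfun \<phi> y \<partial>m x) \<in> bcontfun)"

text \<open>\<^const>\<open>Bcontfun\<close> is only specified on \<^const>\<open>bcontfun\<close>, so the next definition is meaningful only
  for kernels with the Feller property.\<close>

definition feller_operator ::
    "('a::polish_space \<Rightarrow> 'a measure) \<Rightarrow> ('a \<Rightarrow>\<^sub>C real) \<Rightarrow> ('a \<Rightarrow>\<^sub>C real)" where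
  "feller_operator m \<phi> = Bcontfun (\<lambda>x. \<integral>y. apply_bcontfun \<phi> y \<partial>m x)"

lemma apply_feller_operator:
  "feller_property m \<Longrightarrow>
     apply_bcontfun (feller_operator m \<phi>) x = (\<integral>y. apply_bcontfun \<phi> y \<partial>m x)"
  by (simp add: feller_property_def feller_operator_def Bcontfun_inverse)

definition irreducible_chain :: "('a::polish_space \<Rightarrow> 'a measure) \<Rightarrow> bool" where
  "irreducible_chain m \<longleftrightarrow>
     (\<forall>\<phi> :: 'a \<Rightarrow>\<^sub>C real. (\<forall>x. 0 \<le> apply_bcontfun \<phi> x) \<and> \<phi> \<noteq> 0 \<longrightarrow>
        (\<forall>x. \<exists>n\<ge>1. 0 < apply_bcontfun ((feller_operator m ^^ n) \<phi>) x))"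

definition markov_operator ::
    "('a::polish_space \<Rightarrow> 'a measure) \<Rightarrow> 'a measure \<Rightarrow> 'a measure" where
  "markov_operator m \<mu> = Giry_Monad.bind \<mu> m"

lemma sets_markov_operator:
  assumes "transition_kernel m" "prob_space \<mu>" "sets \<mu> = sets borel"
  shows "sets (markov_operator m \<mu>) = sets borel"
  unfolding markov_operator_def
  using assms by (intro sets_bind) (auto simp: transition_kernel_def prob_space.not_empty)

lemma emeasure_markov_operator:
  assumes "transition_kernel m" "prob_space \<mu>" "sets \<mu> = sets borel" "A \<in> sets borel"
  shows "emeasure (markov_operator m \<mu>) A = (\<integral>\<^sup>+x. emeasure (m x) A \<partial>\<mu>)"
proof -
  have "m \<in> \<mu> \<rightarrow>\<^sub>M subprob_algebra borel"
    using assms measurable_prob_algebraD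
    by (simp add: transition_kernel_iff_measurable cong: measurable_cong_sets)
  then show ?thesis
    unfolding markov_operator_def
    using assms by (intro emeasure_bind) (auto simp: prob_space.not_empty)
qed

definition conformal_measure :: "('a::polish_space \<Rightarrow> 'a measure) \<Rightarrow> 'a measure \<Rightarrow> bool" where
  "conformal_measure m \<nu> \<longleftrightarrow>
     prob_space \<nu> \<and> sets \<nu> = sets borel \<and>
     (\<exists>c::real. c > 0 \<and> markov_operator m \<nu> = scale_measure (ennreal c) \<nu>)"

end

theory Submission
  imports Defs
begin

text \<open>Conformality makes the \<open>\<nu>\<close>-null sets absorbing: if \<open>\<nu> A = 0\<close> then \<open>m x A = 0\<close> for
  \<open>\<nu>\<close>-almost every \<open>x\<close>, so \<open>P\<close> preserves the functions vanishing \<open>\<nu>\<close>-almost everywhere. A bump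
  function \<open>\<phi>\<close> supported in a null open set would thus satisfy \<open>P\<^sup>n \<phi> x = 0\<close> for all \<open>n\<close> at
  \<open>\<nu>\<close>-almost every \<open>x\<close>, against irreducibility.\<close>

lemma conformal_measure_null_absorbing:
  assumes m: "transition_kernel m" and \<nu>: "conformal_measure m \<nu>"
    and A: "A \<in> sets borel" "emeasure \<nu> A = 0"
  shows "AE x in \<nu>. emeasure (m x) A = 0"
proof -
  have p: "prob_space \<nu>" and s: "sets \<nu> = sets borel"
    using \<nu> by (auto simp: conformal_measure_def)
  obtain c :: real where "markov_operator m \<nu> = scale_measure (ennreal c) \<nu>"
    using \<nu> by (auto simp: conformal_measure_def)
  \<comment> \<open>Both sides of the conformality equation are evaluated at \<open>A\<close>: the
    integral equals \<open>ennreal c\<close> times the null mass of \<open>A\<close>. A nonnegative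
    integrand with zero integral vanishes almost everywhere.\<close>
  then have "(\<integral>\<^sup>+x. emeasure (m x) A \<partial>\<nu>) = 0"
    using emeasure_markov_operator[OF m p s A(1)] A(2) by simp
  moreover have "(\<lambda>x. emeasure (m x) A) \<in> borel_measurable \<nu>"
    using m A(1) measurable_cong_sets[OF s refl]
    by (auto simp: transition_kernel_iff_measurable intro!: measurable_emeasure_kernel
        dest!: measurable_prob_algebraD)
  ultimately show ?thesis
    by (simp add: nn_integral_0_iff_AE)
qed

text \<open>Absorption is applied to the set where \<open>\<phi>\<close> is nonzero: for almost
  every \<open>x\<close> the kernel \<open>m x\<close> gives it no mass, so the integral of
  \<open>\<phi>\<close> against \<open>m x\<close> is 0.\<close>

lemma feller_operator_AE_zero:
  assumes m: "transition_kernel m" and F: "feller_property m" and \<nu>: "conformal_measure m \<nu>"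
    and \<phi>: "AE x in \<nu>. apply_bcontfun \<phi> x = 0"
  shows "AE x in \<nu>. apply_bcontfun (feller_operator m \<phi>) x = 0"
proof -
  define A where "A = {x. apply_bcontfun \<phi> x \<noteq> 0}"
  have "open A"
    unfolding A_def by (intro open_Collect_neq continuous_intros) auto
  then have A: "A \<in> sets borel" by simp
  have "sets \<nu> = sets borel"
    using \<nu> by (simp add: conformal_measure_def)
  then have "emeasure \<nu> A = 0"
    using \<phi> A sets_eq_imp_space_eq[of \<nu> borel] by (simp add: AE_iff_measurable[of A] A_def)
  from conformal_measure_null_absorbing[OF m \<nu> A this] show ?thesis
  proof eventually_elim
    case (elim x)
    have s: "sets (m x) = sets borel"
      using m by (simp add: transition_kernel_def)
    have "AE y in m x. apply_bcontfun \<phi> y = 0"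
      using elim A s sets_eq_imp_space_eq[OF s] by (simp add: AE_iff_measurable[of A] A_def)
    then show ?case
      unfolding apply_feller_operator[OF F] by (rule integral_eq_zero_AE)
  qed
qed

lemma feller_operator_funpow_AE_zero:
  assumes "transition_kernel m" "feller_property m" "conformal_measure m \<nu>"
    and "AE x in \<nu>. apply_bcontfun \<phi> x = 0"
  shows "AE x in \<nu>. apply_bcontfun ((feller_operator m ^^ n) \<phi>) x = 0"
  by (induction n) (simp_all add: assms(4) feller_operator_AE_zero[OF assms(1-3)])

text \<open>Irreducibility tests only continuous functions, so this bump stands in for the indicator
  of \<open>U\<close>.\<close>

lemma bcontfun_bump:
  fixes U :: "'a::metric_space set"
  assumes "open U" "U \<noteq> {}"
  obtains \<phi> :: "'a \<Rightarrow>\<^sub>C real"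
  where "\<And>x. 0 \<le> apply_bcontfun \<phi> x" "\<phi> \<noteq> 0" "\<And>x. x \<notin> U \<Longrightarrow> apply_bcontfun \<phi> x = 0"
proof -
  obtain a e where e: "0 < e" "ball a e \<subseteq> U"
    using assms by (meson equals0I open_contains_ball)
  \<comment> \<open>A cone with peak value \<open>e\<close> at \<open>a\<close>, cut off at 0 from
    distance \<open>e\<close> on, hence zero outside the ball.\<close>
  define f where "f = (\<lambda>x. max 0 (e - dist a x))"
  have "f \<in> bcontfun"
    unfolding bcontfun_def f_def using e(1)
    by (auto intro!: continuous_intros boundedI[where B = e])
  then have f: "apply_bcontfun (Bcontfun f) = f"
    by (rule Bcontfun_inverse)
  show thesis
  proof (rule that[of "Bcontfun f"])
    have "apply_bcontfun (Bcontfun f) a \<noteq> 0"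
      using e(1) by (simp add: f) (simp add: f_def)
    then show "Bcontfun f \<noteq> 0"
      by auto
    show "0 \<le> apply_bcontfun (Bcontfun f) x" for x
      unfolding f by (simp add: f_def)
    show "apply_bcontfun (Bcontfun f) x = 0" if "x \<notin> U" for x
      unfolding f using e(2) that by (force simp: f_def subset_iff max_def)
  qed
qed

theorem theorem3p2:
  fixes m :: "'a::polish_space \<Rightarrow> 'a measure"
    and \<Omega> :: "'w measure"
    and \<Phi> :: "nat \<Rightarrow> 'w \<Rightarrow> 'a"
  assumes "transition_kernel m"
    and "markov_chain \<Omega> \<Phi> m"
    and "feller_property m"
    and "irreducible_chain m"
    and "bounded_linear (feller_operator m)"
  shows "\<forall>\<nu>. conformal_measure m \<nu> \<longrightarrow> (\<forall>U. open U \<and> U \<noteq> {} \<longrightarrow> emeasure \<nu> U > 0)"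
proof (intro allI impI, elim conjE)
  fix \<nu> :: "'a measure" and U :: "'a set"
  assume \<nu>: "conformal_measure m \<nu>" and U: "open U" "U \<noteq> {}"
  interpret prob_space \<nu>
    using \<nu> by (simp add: conformal_measure_def)
  obtain \<phi> :: "'a \<Rightarrow>\<^sub>C real"
    where \<phi>: "\<And>x. 0 \<le> apply_bcontfun \<phi> x" "\<phi> \<noteq> 0" "\<And>x. x \<notin> U \<Longrightarrow> apply_bcontfun \<phi> x = 0"
    using bcontfun_bump[OF U] by blast
  show "emeasure \<nu> U > 0"
  proof (rule ccontr)
    assume "\<not> emeasure \<nu> U > 0"
    then have "U \<in> null_sets \<nu>"
      using \<nu> U(1) by (auto simp: conformal_measure_def not_less)
    then have "AE x in \<nu>. apply_bcontfun \<phi> x = 0"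
      by (auto dest: AE_not_in elim!: eventually_mono intro: \<phi>(3))
    \<comment> \<open>The exponent given by irreducibility depends on the point, so a single
      \<open>x\<close> must serve all \<open>n\<close>; a countable union of null sets is
      null.\<close>
    then have "AE x in \<nu>. \<forall>n. apply_bcontfun ((feller_operator m ^^ n) \<phi>) x = 0"
      unfolding AE_all_countable
      using feller_operator_funpow_AE_zero[OF assms(1,3) \<nu>] by blast
    \<comment> \<open>An almost sure property holds somewhere because \<open>\<nu>\<close> has total
      mass 1.\<close>
    then obtain x where "\<forall>n. apply_bcontfun ((feller_operator m ^^ n) \<phi>) x = 0"
      using eventually_happens'[OF ae_filter_bot] by blast
    moreover obtain n where "0 < apply_bcontfun ((feller_operator m ^^ n) \<phi>) x"
      using assms(4) \<phi>(1,2) unfolding irreducible_chain_def by blast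
    ultimately show False
      by simp
  qed
qed

end
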